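(* Let $d\geq 1$ be an integer, let $r\geq 0$, and let $\rho$ be a Borel probability measure on $\mathbb{R}^{d}$ with support included in $\mathcal{B}_{r}$. For every integer $n\geq 1$, there exist Borel measures $\rho_{1},\dots,\rho_{n}$ on $\mathbb{R}^{d}$ and subsets $A_{1},\dots,A_{n}$ of $\mathcal{B}_{r}$ such that $\rho=\sum_{k=1}^{n}\rho_{k}$ and, for all $k=1,\dots,n$, $$|\rho_{k}|=\frac{1}{n},\qquad \operatorname{Supp}(\rho_{k})\subset A_{k}\qquad\text{and}\qquad \operatorname{Diam}(A_{k})\leq 4r\,k^{-1/d}.$$
   Context: $\mathbb{R}^{d}$ is equipped with the maximum norm $\|\cdot\|$, and $\mathcal{B}_{r}:=[-r,r]^{d}$ is the closed ball of radius $r$ centered at $0$. For $A\subset\mathbb{R}^{d}$, $\operatorname{Diam}(A):=\sup_{x,y\in A}\|x-y\|$. Measures are nonnegative. For a Borel measure $\nu$ on $\mathbb{R}^{d}$, $\operatorname{Supp}(\nu)$ denotes its support and $|\nu|:=\nu(\mathbb{R}^{d})$ its total mass. *)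

theory Defs
  imports "HOL-Analysis.Analysis" "HOL-Probability.Probability_Measure"
begin

(* The maximum norm on real ^ 'd is the library's infnorm (see infnorm_cart), whereas
   norm, dist and diameter refer to the Euclidean norm. *)

definition max_ball :: "real \<Rightarrow> (real ^ 'd::finite) set" where
  "max_ball r = {x. \<forall>i. x $ i \<in> {-r..r}}"

lemma max_ball_eq_infnorm: "max_ball r = {x. infnorm x \<le> r}"
proof -
  have "infnorm x \<le> r \<longleftrightarrow> (\<forall>i. \<bar>x $ i\<bar> \<le> r)" for x :: "real ^ 'd"
  proof
    assume "infnorm x \<le> r"
    then show "\<forall>i. \<bar>x $ i\<bar> \<le> r"
      using component_le_infnorm_cart[of x] order_trans by blast
  next
    assume "\<forall>i. \<bar>x $ i\<bar> \<le> r"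
    then show "infnorm x \<le> r"
      unfolding infnorm_cart by (intro cSup_least) auto
  qed
  then show ?thesis
    by (auto simp: max_ball_def abs_le_iff minus_le_iff)
qed

(* Modelled on the library's diameter. The supremum is taken in the reals, so the value is
   meaningful only for bounded sets. *)
definition max_diam :: "(real ^ 'd::finite) set \<Rightarrow> real" where
  "max_diam A = (if A = {} then 0 else SUP (x, y)\<in>A \<times> A. infnorm (x - y))"

definition measure_supp :: "'a::topological_space measure \<Rightarrow> 'a set" where
  "measure_supp M = {x. \<forall>U. open U \<and> x \<in> U \<longrightarrow> emeasure M U > 0}"

end

theory Submission
  imports Defs
begin

text \<open>
  The measures are split off greedily, in the order $k = n, n - 1, \dots, 1$. When $\rho_k$ is to
  be chosen, the part of $\rho$ that is left has mass $k/n$. The ball of radius $r$ is covered by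
  $m^d$ cubes of side $2r/m$, where $m = \lfloor k^{1/d} \rfloor$; since $m^d \<le> k$, one of these
  cubes, which becomes $A_k$, carries a remaining mass of at least $1/n$. A suitable multiple of
  the restriction to $A_k$ has mass exactly $1/n$ and can be subtracted. The diameter bound holds
  because $\lfloor t \rfloor \<ge> t/2$ for $t \<ge> 1$. The reverse order serves the bound: the more
  mass is left, the more cubes the pigeonhole principle tolerates, and the larger indices need the
  smaller cubes.

  The greedy argument, \<open>greedy_decomposition\<close>, is independent of geometry: for each \<open>k\<close> it
  asks only for at most \<open>k\<close> measurable sets that cover the space up to a null set. The cubes of
  \<open>max_ball_cover\<close> do so, because the complement of the support is null.
  The cubes are closed, so that a measure concentrated on one of them has its support in it.
\<close>

text \<open>
  Pigeonhole principle: if each of at most \<open>k\<close> sets had mass less than \<open>\<epsilon>\<close>, the total mass would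
  be less than \<open>k * \<epsilon>\<close>.
\<close>

lemma exists_heavy_cover_member:
  assumes "finite_measure \<mu>" and "finite \<C>" and "\<C> \<subseteq> sets \<mu>"
    and null: "emeasure \<mu> (space \<mu> - \<Union>\<C>) = 0"
    and card: "card \<C> \<le> k" and "0 < k" and "0 < \<epsilon>"
    and mass: "measure \<mu> (space \<mu>) = real k * \<epsilon>"
  shows "\<exists>A\<in>\<C>. \<epsilon> \<le> measure \<mu> A"
proof (rule ccontr)
  interpret finite_measure \<mu> by fact
  assume "\<not> ?thesis"
  then have light: "measure \<mu> A < \<epsilon>" if "A \<in> \<C>" for A
    using that by force
  have U: "\<Union>\<C> \<in> sets \<mu>"
    using assms by blast
  have "measure \<mu> (space \<mu>) = measure \<mu> (\<Union>\<C>)"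
    using finite_measure_compl[OF U] null by (simp add: measure_def)
  also have "\<dots> \<le> (\<Sum>A\<in>\<C>. measure \<mu> A)"
    using finite_measure_subadditive_finite[of \<C> "\<lambda>A. A"] assms by simp
  also have "\<dots> < real k * \<epsilon>"
  proof (cases "\<C> = {}")
    case True
    then show ?thesis using assms by simp
  next
    case False
    then have "(\<Sum>A\<in>\<C>. measure \<mu> A) < (\<Sum>A\<in>\<C>. \<epsilon>)"
      using light \<open>finite \<C>\<close> by (intro sum_strict_mono) auto
    also have "\<dots> \<le> real k * \<epsilon>"
      using card \<open>0 < \<epsilon>\<close> by simp
    finally show ?thesis .
  qed
  finally show False
    using mass by simp
qed

lemma emeasure_density_complement_split:
  assumes w: "w \<in> borel_measurable \<mu>" "\<And>x. 0 \<le> w x \<and> w x \<le> (1::real)"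
    and B: "B \<in> sets \<mu>"
  shows "emeasure \<mu> B = emeasure (density \<mu> (\<lambda>x. ennreal (w x))) B
           + emeasure (density \<mu> (\<lambda>x. ennreal (1 - w x))) B"
proof -
  have "emeasure \<mu> B = (\<integral>\<^sup>+x. indicator B x \<partial>\<mu>)"
    using B by simp
  also have "\<dots> = (\<integral>\<^sup>+x. ennreal (w x) * indicator B x + ennreal (1 - w x) * indicator B x \<partial>\<mu>)"
    using w by (intro nn_integral_cong)
      (simp add: distrib_right[symmetric] ennreal_plus[symmetric] del: ennreal_plus)
  also have "\<dots> = emeasure (density \<mu> (\<lambda>x. ennreal (w x))) B
                  + emeasure (density \<mu> (\<lambda>x. ennreal (1 - w x))) B"
    using w B by (simp add: emeasure_density nn_integral_add)
  finally show ?thesis .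
qed

text \<open>
  Rescaling the restriction of \<open>\<mu>\<close> to \<open>A\<close> by a factor \<open>c \<le> 1\<close> leaves the nonnegative remainder
  with density \<open>1 - c * indicator A\<close>; this remainder inherits the null sets of \<open>\<mu>\<close>, hence its covers.
\<close>

lemma split_off_mass:
  assumes "finite_measure \<mu>" and A: "A \<in> sets \<mu>" and "0 < \<epsilon>" and "\<epsilon> \<le> measure \<mu> A"
  obtains \<sigma> \<tau> where "sets \<sigma> = sets \<mu>" and "sets \<tau> = sets \<mu>"
    and "\<And>B. B \<in> sets \<mu> \<Longrightarrow> emeasure \<mu> B = emeasure \<sigma> B + emeasure \<tau> B"
    and "emeasure \<sigma> (space \<mu>) = ennreal \<epsilon>" and "emeasure \<sigma> (space \<mu> - A) = 0"
proof -
  interpret finite_measure \<mu> by fact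
  define c where "c = \<epsilon> / measure \<mu> A"
  have c: "0 \<le> c" "c \<le> 1"
    using assms by (auto simp: c_def)
  define w :: "'a \<Rightarrow> real" where "w = (\<lambda>x. c * indicator A x)"
  have w: "w \<in> borel_measurable \<mu>" "\<And>x. 0 \<le> w x \<and> w x \<le> 1"
    using c A by (auto simp: w_def indicator_def)
  have \<sigma>: "emeasure (density \<mu> (\<lambda>x. ennreal (w x))) B = ennreal c * emeasure \<mu> (A \<inter> B)"
    if "B \<in> sets \<mu>" for B
  proof -
    have "emeasure (density \<mu> (\<lambda>x. ennreal (w x))) B
        = (\<integral>\<^sup>+x. ennreal c * indicator (A \<inter> B) x \<partial>\<mu>)"
      using w that by (auto simp: emeasure_density w_def indicator_def intro!: nn_integral_cong)
    also have "\<dots> = ennreal c * emeasure \<mu> (A \<inter> B)"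
      using A that by (intro nn_integral_cmult_indicator) auto
    finally show ?thesis .
  qed
  have "A \<inter> space \<mu> = A"
    using sets.sets_into_space[OF A] by blast
  then have "emeasure (density \<mu> (\<lambda>x. ennreal (w x))) (space \<mu>) = ennreal c * emeasure \<mu> A"
    using \<sigma>[of "space \<mu>"] by simp
  also have "\<dots> = ennreal \<epsilon>"
    using assms c by (simp add: emeasure_eq_measure ennreal_mult[symmetric] c_def)
  finally have mass: "emeasure (density \<mu> (\<lambda>x. ennreal (w x))) (space \<mu>) = ennreal \<epsilon>" .
  have "A \<inter> (space \<mu> - A) = {}"
    by blast
  then have outside: "emeasure (density \<mu> (\<lambda>x. ennreal (w x))) (space \<mu> - A) = 0"
    using \<sigma>[of "space \<mu> - A"] A by simp
  show ?thesis
    using mass outside emeasure_density_complement_split[OF w]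
    by (intro that[of "density \<mu> (\<lambda>x. ennreal (w x))" "density \<mu> (\<lambda>x. ennreal (1 - w x))"]) auto
qed

text \<open>
  The induction removes the piece with the largest index first: it is the one for which a
  remaining mass of \<open>k * \<epsilon>\<close> is available to be spread over \<open>k\<close> sets.
\<close>

lemma greedy_decomposition:
  fixes \<mu> :: "'a measure" and \<C> :: "nat \<Rightarrow> 'a set set"
  assumes "finite_measure \<mu>" and "0 < \<epsilon>"
    and mass: "emeasure \<mu> (space \<mu>) = ennreal (real n * \<epsilon>)"
    and cover: "\<And>k. k \<in> {1..n} \<Longrightarrow> finite (\<C> k) \<and> card (\<C> k) \<le> k \<and> \<C> k \<subseteq> sets \<mu>
                  \<and> emeasure \<mu> (space \<mu> - \<Union>(\<C> k)) = 0"
  shows "\<exists>\<sigma> A. (\<forall>k\<in>{1..n}. sets (\<sigma> k) = sets \<mu> \<and> A k \<in> \<C> k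
              \<and> emeasure (\<sigma> k) (space \<mu>) = ennreal \<epsilon> \<and> emeasure (\<sigma> k) (space \<mu> - A k) = 0)
          \<and> (\<forall>B\<in>sets \<mu>. emeasure \<mu> B = (\<Sum>k=1..n. emeasure (\<sigma> k) B))"
  using assms(1,3,4)
proof (induction n arbitrary: \<mu>)
  case 0
  then have "emeasure \<mu> B = 0" for B
    using emeasure_space[of \<mu> B] by simp
  then show ?case
    by simp
next
  case (Suc n)
  interpret finite_measure \<mu> by (rule Suc.prems)
  have "measure \<mu> (space \<mu>) = real (Suc n) * \<epsilon>"
    using Suc.prems(2) \<open>0 < \<epsilon>\<close> by (simp add: measure_def)
  then obtain A0 where A0: "A0 \<in> \<C> (Suc n)" "\<epsilon> \<le> measure \<mu> A0"
    using exists_heavy_cover_member[of \<mu> "\<C> (Suc n)" "Suc n" \<epsilon>]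
      Suc.prems(1) Suc.prems(3)[of "Suc n"] \<open>0 < \<epsilon>\<close> by auto
  have "A0 \<in> sets \<mu>"
    using Suc.prems(3)[of "Suc n"] A0 by auto
  then obtain \<sigma>0 \<tau> where \<sigma>0: "sets \<sigma>0 = sets \<mu>"
    and \<tau>: "sets \<tau> = sets \<mu>"
    and split: "\<And>B. B \<in> sets \<mu> \<Longrightarrow> emeasure \<mu> B = emeasure \<sigma>0 B + emeasure \<tau> B"
    and mass0: "emeasure \<sigma>0 (space \<mu>) = ennreal \<epsilon>"
    and conc0: "emeasure \<sigma>0 (space \<mu> - A0) = 0"
    using split_off_mass[OF Suc.prems(1) _ \<open>0 < \<epsilon>\<close> A0(2)] by metis
  have sp: "space \<tau> = space \<mu>"
    using sets_eq_imp_space_eq[OF \<tau>] .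
  have "ennreal (real n * \<epsilon>) + ennreal \<epsilon> = emeasure \<tau> (space \<mu>) + ennreal \<epsilon>"
    using split[of "space \<mu>"] mass0 Suc.prems(2) \<open>0 < \<epsilon>\<close>
    by (simp add: add.commute ennreal_plus[symmetric] algebra_simps del: ennreal_plus)
  then have mass\<tau>: "emeasure \<tau> (space \<tau>) = ennreal (real n * \<epsilon>)"
    by (simp add: sp)
  then have fin\<tau>: "finite_measure \<tau>"
    by (intro finite_measureI) simp
  have cover\<tau>: "finite (\<C> k) \<and> card (\<C> k) \<le> k \<and> \<C> k \<subseteq> sets \<tau>
      \<and> emeasure \<tau> (space \<tau> - \<Union>(\<C> k)) = 0" if "k \<in> {1..n}" for k
  proof -
    have k: "finite (\<C> k)" "card (\<C> k) \<le> k" "\<C> k \<subseteq> sets \<mu>"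
        "emeasure \<mu> (space \<mu> - \<Union>(\<C> k)) = 0"
      using Suc.prems(3)[of k] that by auto
    moreover have "space \<mu> - \<Union>(\<C> k) \<in> sets \<mu>"
      using k by (intro sets.Diff sets.finite_Union) auto
    ultimately show ?thesis
      using split[of "space \<mu> - \<Union>(\<C> k)"] by (simp add: \<tau> sp)
  qed
  obtain \<sigma> A where IH: "\<And>k. k \<in> {1..n} \<Longrightarrow> sets (\<sigma> k) = sets \<tau> \<and> A k \<in> \<C> k
        \<and> emeasure (\<sigma> k) (space \<tau>) = ennreal \<epsilon> \<and> emeasure (\<sigma> k) (space \<tau> - A k) = 0"
      and sum: "\<And>B. B \<in> sets \<tau> \<Longrightarrow> emeasure \<tau> B = (\<Sum>k=1..n. emeasure (\<sigma> k) B)"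
    using Suc.IH[OF fin\<tau> mass\<tau> cover\<tau>] by blast
  have pieces: "sets ((\<sigma>(Suc n := \<sigma>0)) k) = sets \<mu> \<and> (A(Suc n := A0)) k \<in> \<C> k
        \<and> emeasure ((\<sigma>(Suc n := \<sigma>0)) k) (space \<mu>) = ennreal \<epsilon>
        \<and> emeasure ((\<sigma>(Suc n := \<sigma>0)) k) (space \<mu> - (A(Suc n := A0)) k) = 0"
    if "k \<in> {1..Suc n}" for k
    using IH[of k] that \<sigma>0 mass0 conc0 A0(1) by (cases "k = Suc n") (auto simp: \<tau> sp)
  have total: "emeasure \<mu> B = (\<Sum>k=1..Suc n. emeasure ((\<sigma>(Suc n := \<sigma>0)) k) B)"
    if "B \<in> sets \<mu>" for B
  proof -
    have "(\<Sum>k=1..n. emeasure ((\<sigma>(Suc n := \<sigma>0)) k) B) = (\<Sum>k=1..n. emeasure (\<sigma> k) B)"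
      by (intro sum.cong) auto
    then show ?thesis
      using split[OF that] sum[of B] that \<tau> by (simp add: add.commute)
  qed
  show ?case
    using pieces total by blast
qed

text \<open>
  The complement of the support is a union of open null sets, and by second countability
  countably many of them suffice.
\<close>

lemma compl_measure_supp_null:
  fixes M :: "'a::second_countable_topology measure"
  assumes "sets M = sets borel"
  shows "- measure_supp M \<in> null_sets M"
proof -
  define \<F> where "\<F> = {U. open U \<and> emeasure M U = 0}"
  have "- measure_supp M = \<Union>\<F>"
    by (auto simp: measure_supp_def \<F>_def zero_less_iff_neq_zero)
  moreover obtain \<F>' where \<F>': "\<F>' \<subseteq> \<F>" "countable \<F>'" "\<Union>\<F>' = \<Union>\<F>"
    using Lindelof[of \<F>] unfolding \<F>_def by auto
  moreover have "(\<Union>U\<in>\<F>'. U) \<in> null_sets M"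
    using \<F>' assms by (intro null_sets_UN') (auto simp: \<F>_def null_sets_def)
  ultimately show ?thesis
    by auto
qed

lemma measure_supp_subset_closed:
  assumes "closed A" and "emeasure M (- A) = 0"
  shows "measure_supp M \<subseteq> A"
  using assms by (force simp: measure_supp_def)

text \<open>
  The least admissible \<open>j\<close> works: minimality gives the lower bound.
\<close>

lemma exists_grid_interval:
  fixes a r :: real and m :: nat
  assumes "0 < m" and "a \<in> {-r..r}"
  shows "\<exists>j<m. a \<in> {-r + 2 * r / m * real j .. -r + 2 * r / m * (real j + 1)}"
proof -
  define P where "P = (\<lambda>j::nat. a \<le> -r + 2 * r / m * (real j + 1))"
  have "2 * r / m * (real (m - 1) + 1) = 2 * r"
    using \<open>0 < m\<close> by (simp add: of_nat_diff)
  then have P: "P (m - 1)"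
    using assms by (simp add: P_def)
  define j where "j = (LEAST j. P j)"
  have "P j" "j \<le> m - 1"
    unfolding j_def using P by (auto intro: LeastI Least_le)
  moreover have "-r + 2 * r / m * real j \<le> a"
  proof (cases j)
    case 0
    then show ?thesis using assms by simp
  next
    case (Suc i)
    then have "\<not> P i"
      using not_less_Least[of i P] by (simp add: j_def)
    then show ?thesis
      using Suc by (simp add: P_def add.commute)
  qed
  ultimately show ?thesis
    using \<open>0 < m\<close> by (intro exI[of _ j]) (auto simp: P_def)
qed

lemma max_diam_cbox_le:
  fixes a b :: "real ^ 'd::finite"
  assumes "0 \<le> s" and "\<And>i. b $ i - a $ i \<le> s"
  shows "max_diam (cbox a b) \<le> s"
proof (cases "cbox a b = {}")
  case True
  then show ?thesis using assms by (simp add: max_diam_def)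
next
  case False
  have "infnorm (x - y) \<le> s" if "x \<in> cbox a b" "y \<in> cbox a b" for x y
  proof -
    have "\<bar>(x - y) $ i\<bar> \<le> s" for i
      using that assms(2)[of i] by (auto simp: mem_box_cart abs_le_iff dest!: spec[of _ i])
    then show ?thesis
      unfolding infnorm_cart by (intro cSup_least) auto
  qed
  then show ?thesis
    using False by (auto simp: max_diam_def intro!: cSUP_least)
qed

text \<open>
  The cubes of the grid with \<open>m\<close> intervals per axis are indexed by the \<open>m ^ CARD('d)\<close> functions
  from coordinates to \<open>{..<m}\<close>; different indices may give the same cube (when \<open>r = 0\<close>), so only
  an upper bound on their number is asserted.
\<close>

lemma grid_cover:
  fixes r :: real and m :: nat
  assumes "0 \<le> r" and "0 < m"
  shows "\<exists>\<C> :: (real ^ 'd::finite) set set. finite \<C> \<and> card \<C> \<le> m ^ CARD('d) \<and> \<Union>\<C> = max_ball r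
           \<and> (\<forall>A\<in>\<C>. closed A \<and> max_diam A \<le> 2 * r / m)"
proof -
  define I :: "('d \<Rightarrow> nat) set" where "I = (\<Pi>\<^sub>E i\<in>UNIV. {..<m})"
  define cube :: "('d \<Rightarrow> nat) \<Rightarrow> (real ^ 'd) set" where
    "cube = (\<lambda>q. cbox (\<chi> i. -r + 2 * r / m * real (q i)) (\<chi> i. -r + 2 * r / m * (real (q i) + 1)))"
  have fin: "finite I"
    unfolding I_def by (intro finite_PiE) auto
  have "card I = m ^ CARD('d)"
    by (simp add: I_def card_PiE)
  then have card: "card (cube ` I) \<le> m ^ CARD('d)"
    using card_image_le[OF fin, of cube] by simp
  have "x \<in> max_ball r" if "q \<in> I" "x \<in> cube q" for q x
    unfolding max_ball_def
  proof (clarify)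
    fix i
    have "real (q i) + 1 \<le> real m"
      using that(1) by (auto simp: I_def PiE_iff Suc_le_eq dest!: spec[of _ i])
    then have "2 * r / m * (real (q i) + 1) \<le> 2 * r / m * real m"
      using assms by (intro mult_left_mono) auto
    moreover have "2 * r / m * real m = 2 * r" "0 \<le> 2 * r / m * real (q i)"
      using assms by auto
    ultimately show "x $ i \<in> {-r..r}"
      using that(2) unfolding cube_def mem_box_cart
      by (auto simp del: times_divide_eq_left dest!: spec[of _ i])
  qed
  moreover have "x \<in> \<Union>(cube ` I)" if "x \<in> max_ball r" for x
  proof -
    have "\<forall>i. \<exists>j<m. x $ i \<in> {-r + 2 * r / m * real j .. -r + 2 * r / m * (real j + 1)}"
      using that exists_grid_interval[OF \<open>0 < m\<close>] by (simp add: max_ball_def)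
    then obtain q where "\<forall>i. q i < m \<and>
        x $ i \<in> {-r + 2 * r / m * real (q i) .. -r + 2 * r / m * (real (q i) + 1)}"
      by metis
    then have "q \<in> I" "x \<in> cube q"
      by (auto simp: I_def cube_def mem_box_cart)
    then show ?thesis by blast
  qed
  ultimately have "\<Union>(cube ` I) = max_ball r"
    by blast
  moreover have "max_diam (cube q) \<le> 2 * r / m" for q
    unfolding cube_def using assms by (intro max_diam_cbox_le) (auto simp: field_simps)
  moreover have "closed (cube q)" for q
    unfolding cube_def by (rule closed_cbox)
  ultimately show ?thesis
    using fin card by (intro exI[of _ "cube ` I"]) auto
qed

text \<open>
  The number of intervals per axis is \<open>m = \<lfloor>k powr (1 / d)\<rfloor>\<close>, which satisfies
  \<open>m ^ d \<le> k\<close> and \<open>k powr (1 / d) < m + 1 \<le> 2 * m\<close>.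
\<close>

lemma max_ball_cover:
  fixes r :: real and k :: nat
  assumes "0 \<le> r" and "1 \<le> k"
  shows "\<exists>\<C> :: (real ^ 'd::finite) set set. finite \<C> \<and> card \<C> \<le> k \<and> \<Union>\<C> = max_ball r
           \<and> (\<forall>A\<in>\<C>. closed A \<and> max_diam A \<le> 4 * r * real k powr (- 1 / real CARD('d)))"
proof -
  define t where "t = real k powr (1 / real CARD('d))"
  define m where "m = nat \<lfloor>t\<rfloor>"
  have "1 \<le> t"
    unfolding t_def using assms by (intro ge_one_powr_ge_zero) auto
  then have m: "0 < m" "real m \<le> t" "t < real m + 1"
    unfolding m_def by linarith+
  have "real (m ^ CARD('d)) \<le> t ^ CARD('d)"
    using m by (simp add: power_mono)
  also have "\<dots> = real k"
    using assms by (simp add: t_def powr_power)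
  finally have pow: "m ^ CARD('d) \<le> k"
    by linarith
  have "t \<le> 2 * real m" "0 < real m"
    using m by linarith+
  then have "2 * r / m \<le> 4 * r / t"
    using assms \<open>1 \<le> t\<close> mult_left_mono[of t "2 * real m" r] by (simp add: field_simps)
  also have "\<dots> = 4 * r * real k powr (- 1 / real CARD('d))"
    by (simp add: t_def powr_minus_divide)
  finally have side: "2 * r / m \<le> 4 * r * real k powr (- 1 / real CARD('d))" .
  show ?thesis
    using grid_cover[OF \<open>0 \<le> r\<close> \<open>0 < m\<close>, where 'd = 'd] pow side by (meson order_trans)
qed

theorem theorem3p2:
  fixes \<rho> :: "(real ^ 'd::finite) measure" and r :: real and n :: nat
  assumes "r \<ge> 0"
    and "sets \<rho> = sets borel" and "prob_space \<rho>"
    and "measure_supp \<rho> \<subseteq> max_ball r"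
    and "n \<ge> 1"
  shows "\<exists>(\<rho>s :: nat \<Rightarrow> (real ^ 'd) measure) (A :: nat \<Rightarrow> (real ^ 'd) set).
    (\<forall>k\<in>{1..n}. sets (\<rho>s k) = sets borel \<and> A k \<subseteq> max_ball r) \<and>
    (\<forall>B\<in>sets borel. emeasure \<rho> B = (\<Sum>k=1..n. emeasure (\<rho>s k) B)) \<and>
    (\<forall>k\<in>{1..n}.
      emeasure (\<rho>s k) UNIV = ennreal (1 / real n) \<and>
      measure_supp (\<rho>s k) \<subseteq> A k \<and>
      max_diam (A k) \<le> 4 * r * real k powr (- 1 / real CARD('d)))"
proof -
  interpret prob_space \<rho> by fact
  have sp: "space \<rho> = UNIV"
    using sets_eq_imp_space_eq[OF assms(2)] by simp
  obtain \<C> :: "nat \<Rightarrow> (real ^ 'd) set set" where \<C>: "\<And>k. 1 \<le> k \<Longrightarrow> finite (\<C> k) \<and> card (\<C> k) \<le> k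
      \<and> \<Union>(\<C> k) = max_ball r
      \<and> (\<forall>A\<in>\<C> k. closed A \<and> max_diam A \<le> 4 * r * real k powr (- 1 / real CARD('d)))"
    using max_ball_cover[OF \<open>r \<ge> 0\<close>, where 'd = 'd] by metis
  have null: "emeasure \<rho> (- max_ball r) = 0"
  proof -
    have "emeasure \<rho> (- max_ball r) \<le> emeasure \<rho> (- measure_supp \<rho>)"
      using assms(4) compl_measure_supp_null[OF assms(2)] by (intro emeasure_mono) auto
    then show ?thesis
      using compl_measure_supp_null[OF assms(2)] by auto
  qed
  have cover: "finite (\<C> k) \<and> card (\<C> k) \<le> k \<and> \<C> k \<subseteq> sets \<rho>
      \<and> emeasure \<rho> (space \<rho> - \<Union>(\<C> k)) = 0" if "k \<in> {1..n}" for k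
  proof -
    have k: "1 \<le> k"
      using that by simp
    have "\<C> k \<subseteq> sets \<rho>"
      using \<C>[OF k] by (auto simp: assms(2))
    moreover have "space \<rho> - \<Union>(\<C> k) = - max_ball r"
      using \<C>[OF k] sp by (simp add: Compl_eq_Diff_UNIV)
    ultimately show ?thesis
      using \<C>[OF k] null by metis
  qed
  have mass: "emeasure \<rho> (space \<rho>) = ennreal (real n * (1 / real n))" and pos: "0 < 1 / real n"
    using \<open>n \<ge> 1\<close> emeasure_space_1 by auto
  obtain \<rho>s A where parts: "\<And>k. k \<in> {1..n} \<Longrightarrow> sets (\<rho>s k) = sets \<rho> \<and> A k \<in> \<C> k
        \<and> emeasure (\<rho>s k) (space \<rho>) = ennreal (1 / real n) \<and> emeasure (\<rho>s k) (space \<rho> - A k) = 0"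
      and total: "\<And>B. B \<in> sets \<rho> \<Longrightarrow> emeasure \<rho> B = (\<Sum>k=1..n. emeasure (\<rho>s k) B)"
    using greedy_decomposition[OF finite_measure_axioms pos mass cover] by metis
  have "A k \<subseteq> max_ball r \<and> measure_supp (\<rho>s k) \<subseteq> A k
      \<and> max_diam (A k) \<le> 4 * r * real k powr (- 1 / real CARD('d))" if k: "k \<in> {1..n}" for k
  proof -
    have "A k \<in> \<C> k" "emeasure (\<rho>s k) (- A k) = 0"
      using parts[OF k] by (simp_all add: sp Compl_eq_Diff_UNIV)
    moreover have "1 \<le> k"
      using k by simp
    ultimately show ?thesis
      using \<C>[of k] measure_supp_subset_closed[of "A k" "\<rho>s k"] by blast
  qed
  then show ?thesis
    using parts total by (intro exI[of _ \<rho>s] exI[of _ A]) (auto simp: sp assms(2))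
qed

end
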